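(* For every pair $a,b$ of integers with $2\leq a\leq b$, there exists a connected graph $G$ with $\dim(G)=a$ and $\dim^+(G)=b$.
   Context: Graphs are finite and simple; $d(u,v)$ is the length of a shortest $u$-$v$ path. A vertex $w$ resolves a pair $\{x,y\}$ if $d(w,x)\neq d(w,y)$. A set $S\subseteq V(G)$ is a resolving set if every pair of vertices is resolved by some vertex of $S$. The metric dimension $\dim(G)$ is the minimum size of a resolving set. A resolving set is minimal if no proper subset of it is a resolving set; the upper dimension $\dim^+(G)$ is the maximum size of a minimal resolving set. *)

theory Defs
  imports "Graph_Theory.Graph_Theory" "HOL-Library.Extended_Nat"
begin

text \<open>
  Finite simple graphs are rendered by the locale \<^locale>\<open>pair_graph\<close>: an undirected edge is a
  pair of opposite arcs, so the length of a path is its number of arcs. The distance is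
  \<^term>\<open>\<infinity>\<close> if there is no path.
\<close>

definition graph_dist :: "('a, 'b) pre_digraph \<Rightarrow> 'a \<Rightarrow> 'a \<Rightarrow> enat" where
  "graph_dist G u v = (INF p \<in> {p. pre_digraph.apath G u p v}. enat (length p))"

definition resolves :: "('a, 'b) pre_digraph \<Rightarrow> 'a \<Rightarrow> 'a \<Rightarrow> 'a \<Rightarrow> bool" where
  "resolves G w x y \<longleftrightarrow> graph_dist G w x \<noteq> graph_dist G w y"

definition resolving_set :: "('a, 'b) pre_digraph \<Rightarrow> 'a set \<Rightarrow> bool" where
  "resolving_set G S \<longleftrightarrow> S \<subseteq> verts G \<and>
    (\<forall>x \<in> verts G. \<forall>y \<in> verts G. x \<noteq> y \<longrightarrow> (\<exists>w \<in> S. resolves G w x y))"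

definition minimal_resolving_set :: "('a, 'b) pre_digraph \<Rightarrow> 'a set \<Rightarrow> bool" where
  "minimal_resolving_set G S \<longleftrightarrow> resolving_set G S \<and> (\<forall>T. T \<subset> S \<longrightarrow> \<not> resolving_set G T)"

text \<open>
  If \<^term>\<open>verts G\<close> is finite, the sets below are finite and nonempty, since \<^term>\<open>verts G\<close> is
  itself a resolving set.
\<close>

definition metric_dim :: "('a, 'b) pre_digraph \<Rightarrow> nat" where
  "metric_dim G = Min (card ` {S. resolving_set G S})"

definition upper_dim :: "('a, 'b) pre_digraph \<Rightarrow> nat" where
  "upper_dim G = Max (card ` {S. minimal_resolving_set G S})"

end

theory Submission
  imports Defs "HOL-Library.Countable"
begin

text \<open>
  Take three paths \<open>X\<close>, \<open>M\<close>, \<open>Y\<close> on \<open>k = b - a + 1\<close> vertices each, with a rung joining the middle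
  path \<open>M\<close> at level \<open>i\<close> to \<open>X\<close> if \<open>i\<close> is even and to \<open>Y\<close> if \<open>i\<close> is odd. Join the three vertices of level
  \<open>0\<close> to a hub \<open>H\<close>, and let \<open>H\<close> and \<open>K 0, \<dots>, K (a - 1)\<close> form a clique. The vertices \<open>K i\<close> are twins,
  so every resolving set omits at most one of them, and a single \<open>K i\<close> tells all levels apart.
  The only real difficulty left is to separate \<open>X i\<close> from \<open>Y i\<close>: every vertex on the outer paths
  does so for all \<open>i\<close> at once, whereas \<open>M j\<close>, which can reach either side at equal cost once it
  moves by a level, does so for \<open>i = j\<close> only. Hence \<open>a - 1\<close> clique vertices are completed to a minimal
  resolving set by the single vertex \<open>X 0\<close> as well as by all of \<open>M\<close>, which gives the sizes \<open>a\<close> and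
  \<open>a - 1 + k = b\<close>.
\<close>

section \<open>Graphs given by an explicit distance function\<close>

text \<open>An arc lowers \<open>f\<close> by at most 1, so summing along the walk bounds its length
  below.\<close>

lemma (in wf_digraph) length_awalk_ge_potential:
  fixes f :: "'a \<Rightarrow> nat"
  assumes "\<And>e. e \<in> arcs G \<Longrightarrow> f (tail G e) \<le> f (head G e) + 1"
    and "awalk u p v"
  shows "f u \<le> f v + length p"
  using assms(2)
proof (induction p arbitrary: u)
  case Nil
  then show ?case by (simp add: awalk_Nil_iff)
next
  case (Cons e p)
  then have "e \<in> arcs G" "u = tail G e" "f (head G e) \<le> f v + length p"
    by (auto simp: awalk_Cons_iff)
  with assms(1)[of e] show ?case by simp
qed

text \<open>Following descending arcs reaches \<open>v\<close>. The bound on \<open>f\<close> along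
  the walk strengthens the induction: the vertex prepended has a strictly larger value, so it is not
  repeated and the walk is a path.\<close>

lemma (in wf_digraph) apath_of_descending_potential:
  fixes f :: "'a \<Rightarrow> nat"
  assumes "f v = 0" and "v \<in> verts G"
    and "\<And>u. u \<in> verts G \<Longrightarrow> u \<noteq> v \<Longrightarrow> \<exists>e\<in>arcs G. tail G e = u \<and> f u = f (head G e) + 1"
    and "u \<in> verts G"
  shows "\<exists>p. apath u p v \<and> length p = f u \<and> (\<forall>w\<in>set (awalk_verts u p). f w \<le> f u)"
  using assms(4)
proof (induction "f u" arbitrary: u)
  case 0
  with assms(3)[of u] have "u = v" by fastforce
  with 0 assms(1) show ?case by (intro exI[of _ "[]"]) (simp add: apath_Nil_iff)
next
  case (Suc n)
  with assms(1) assms(3)[of u] obtain e where e: "e \<in> arcs G" "tail G e = u" "f u = f (head G e) + 1"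
    by fastforce
  with Suc obtain p where "apath (head G e) p v" "length p = f (head G e)"
    "\<forall>w\<in>set (awalk_verts (head G e) p). f w \<le> f (head G e)"
    by (metis Suc_eq_plus1 add_right_cancel head_in_verts)
  with e show ?case
    by (intro exI[of _ "e # p"]) (force simp: apath_Cons_iff)
qed

text \<open>Reduces computing a distance to two local checks, one for each inequality.\<close>

lemma (in wf_digraph) graph_dist_eq_potential:
  fixes f :: "'a \<Rightarrow> nat"
  assumes "f v = 0" and "v \<in> verts G"
    and "\<And>e. e \<in> arcs G \<Longrightarrow> f (tail G e) \<le> f (head G e) + 1"
    and "\<And>u. u \<in> verts G \<Longrightarrow> u \<noteq> v \<Longrightarrow> \<exists>e\<in>arcs G. tail G e = u \<and> f u = f (head G e) + 1"
    and "u \<in> verts G"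
  shows "graph_dist G u v = enat (f u)"
proof -
  obtain p where p: "apath u p v" "length p = f u"
    using apath_of_descending_potential[OF assms(1,2,4,5)] by blast
  show ?thesis unfolding graph_dist_def
  proof (intro antisym)
    show "(INF p\<in>{p. apath u p v}. enat (length p)) \<le> enat (f u)"
      using p by (intro INF_lower2[of p]) auto
    show "enat (f u) \<le> (INF p\<in>{p. apath u p v}. enat (length p))"
      using length_awalk_ge_potential[OF assms(3)] assms(1)
      by (intro INF_greatest) (fastforce simp: apath_def)
  qed
qed

section \<open>Transfer of resolving sets to a graph on natural numbers\<close>

locale graph_with_dist =
  fixes V :: "'v::countable set" and E :: "'v \<Rightarrow> 'v \<Rightarrow> bool" and D :: "'v \<Rightarrow> 'v \<Rightarrow> nat"
  assumes finite_V: "finite V" and V_nonempty: "V \<noteq> {}"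
    and E_irrefl: "\<not> E u u"
    and E_sym: "E u v \<Longrightarrow> E v u"
    and D_refl: "D u u = 0"
    and D_step: "E u v \<Longrightarrow> D u w \<le> D v w + 1"
    and D_descent: "u \<in> V \<Longrightarrow> w \<in> V \<Longrightarrow> u \<noteq> w \<Longrightarrow> \<exists>v\<in>V. E u v \<and> D u w = D v w + 1"
begin

definition resolving :: "'v set \<Rightarrow> bool" where
  "resolving T \<longleftrightarrow> T \<subseteq> V \<and> (\<forall>x\<in>V. \<forall>y\<in>V. x \<noteq> y \<longrightarrow> (\<exists>w\<in>T. D w x \<noteq> D w y))"

definition coded :: "nat pair_pre_digraph" where
  "coded = \<lparr>pverts = to_nat ` V, parcs = {(to_nat u, to_nat v) | u v. u \<in> V \<and> v \<in> V \<and> E u v}\<rparr>"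

lemma verts_coded [simp]: "pverts coded = to_nat ` V"
  and arcs_coded: "parcs coded = {(to_nat u, to_nat v) | u v. u \<in> V \<and> v \<in> V \<and> E u v}"
  by (simp_all add: coded_def)

lemma pair_graph_coded: "pair_graph coded"
proof
  have "parcs coded \<subseteq> to_nat ` V \<times> to_nat ` V"
    by (auto simp: arcs_coded)
  then show "finite (parcs coded)"
    by (rule finite_subset) (simp add: finite_V)
  show "symmetric (with_proj coded)"
    by (auto simp: symmetric_def arcs_coded intro!: symI dest: E_sym)
qed (auto simp: arcs_coded finite_V E_irrefl)

sublocale pg: pair_graph coded
  by (rule pair_graph_coded)

lemma graph_dist_coded:
  assumes "u \<in> V" "v \<in> V"
  shows "graph_dist (with_proj coded) (to_nat u) (to_nat v) = enat (D u v)"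
proof -
  \<comment> \<open>\<open>from_nat\<close> undoes the encoding; by \<open>D_step\<close> and
    \<open>D_descent\<close> this is a potential towards \<open>v\<close>.\<close>
  define f where "f n = D (from_nat n) v" for n
  have "graph_dist (with_proj coded) (to_nat u) (to_nat v) = enat (f (to_nat u))"
  proof (rule pg.graph_dist_eq_potential)
    fix n assume "n \<in> pverts coded" "n \<noteq> to_nat v"
    then obtain x where x: "x \<in> V" "n = to_nat x" "x \<noteq> v" by auto
    with D_descent[of x v] assms obtain y where "y \<in> V" "E x y" "D x v = D y v + 1" by auto
    with x show "\<exists>e\<in>parcs coded. fst e = n \<and> f n = f (snd e) + 1"
      by (intro bexI[of _ "(to_nat x, to_nat y)"]) (auto simp: f_def arcs_coded)
  next
    fix e assume "e \<in> parcs coded"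
    then show "f (fst e) \<le> f (snd e) + 1"
      by (auto simp: f_def arcs_coded D_step[simplified])
  qed (use assms in \<open>auto simp: f_def D_refl\<close>)
  then show ?thesis by (simp add: f_def)
qed

lemma resolving_set_coded: "resolving_set (with_proj coded) (to_nat ` T) \<longleftrightarrow> resolving T"
proof (cases "T \<subseteq> V")
  case True
  then have "graph_dist (with_proj coded) (to_nat w) (to_nat x) = enat (D w x)"
    if "w \<in> T" "x \<in> V" for w x
    using that by (intro graph_dist_coded) auto
  with True show ?thesis
    by (auto simp: resolving_set_def resolving_def resolves_def)
next
  case False
  then show ?thesis by (auto simp: resolving_set_def resolving_def)
qed

lemma resolving_sets_coded:
  "resolving_set (with_proj coded) S \<longleftrightarrow> (\<exists>T. resolving T \<and> S = to_nat ` T)"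
proof
  assume S: "resolving_set (with_proj coded) S"
  then obtain T :: "'v set" where "S = to_nat ` T"
    unfolding resolving_set_def with_proj_simps verts_coded by (meson subset_imageE)
  with S show "\<exists>T. resolving T \<and> S = to_nat ` T" by (auto simp: resolving_set_coded)
qed (auto simp: resolving_set_coded)

lemma card_to_nat_image: "card (to_nat ` T) = card (T :: 'v set)"
  by (intro card_image inj_on_subset[OF inj_to_nat]) auto

lemma finite_resolving_sets: "finite {S. resolving_set (with_proj coded) S}"
  by (rule finite_subset[of _ "Pow (to_nat ` V)"]) (auto simp: resolving_set_def finite_V)

lemma metric_dim_coded:
  assumes "resolving T" and "\<And>T'. resolving T' \<Longrightarrow> card T \<le> card T'"
  shows "metric_dim (with_proj coded) = card T"
  unfolding metric_dim_def
proof (rule Min_eqI)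
  show "card T \<in> card ` {S. resolving_set (with_proj coded) S}"
    using assms(1) by (auto simp: image_iff resolving_set_coded card_to_nat_image
        intro!: exI[of _ "to_nat ` T"])
  show "finite (card ` {S. resolving_set (with_proj coded) S})"
    by (intro finite_imageI finite_resolving_sets)
qed (use assms(2) in \<open>auto simp: resolving_sets_coded card_to_nat_image\<close>)

text \<open>A minimal resolving set equals each of its resolving subsets, so the upper bound only
  has to be found for some resolving subset of every resolving set.\<close>

lemma upper_dim_coded:
  assumes "resolving T" and "\<And>T'. T' \<subset> T \<Longrightarrow> \<not> resolving T'"
    and "\<And>T'. resolving T' \<Longrightarrow> \<exists>R\<subseteq>T'. resolving R \<and> card R \<le> card T"
  shows "upper_dim (with_proj coded) = card T"
  unfolding upper_dim_def
proof (rule Max_eqI)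
  have "minimal_resolving_set (with_proj coded) (to_nat ` T)"
    unfolding minimal_resolving_set_def
  proof (intro conjI allI impI notI)
    fix S assume S: "S \<subset> to_nat ` T" "resolving_set (with_proj coded) S"
    then obtain T' where T': "resolving T'" "S = to_nat ` T'" by (auto simp: resolving_sets_coded)
    with S(1) have "T' \<subset> T"
      by (auto simp: psubset_eq inj_image_subset_iff[OF inj_to_nat])
    with T'(1) assms(2) show False by blast
  qed (simp add: resolving_set_coded assms(1))
  then show "card T \<in> card ` {S. minimal_resolving_set (with_proj coded) S}"
    by (intro image_eqI[of _ _ "to_nat ` T"]) (simp_all add: card_to_nat_image)
next
  show "finite (card ` {S. minimal_resolving_set (with_proj coded) S})"
    by (intro finite_imageI finite_subset[OF _ finite_resolving_sets])
      (auto simp: minimal_resolving_set_def)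
next
  fix n assume "n \<in> card ` {S. minimal_resolving_set (with_proj coded) S}"
  then obtain S where S: "n = card S" "minimal_resolving_set (with_proj coded) S"
    by blast
  from S(2) have res: "resolving_set (with_proj coded) S"
    and min: "\<And>S'. S' \<subset> S \<Longrightarrow> \<not> resolving_set (with_proj coded) S'"
    by (simp_all add: minimal_resolving_set_def)
  from res obtain T' where T': "resolving T'" "S = to_nat ` T'"
    by (auto simp: resolving_sets_coded)
  from assms(3)[OF T'(1)] obtain R where R: "R \<subseteq> T'" "resolving R" "card R \<le> card T"
    by blast
  from R(2) have "resolving_set (with_proj coded) (to_nat ` R)"
    by (simp only: resolving_set_coded)
  with min have "\<not> to_nat ` R \<subset> S" by auto
  moreover have "to_nat ` R \<subseteq> S"
    unfolding T'(2) by (rule image_mono) (rule R(1))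
  ultimately have "card (to_nat ` R) = card S" by auto
  with R(3) S(1) show "n \<le> card T" by (simp add: card_to_nat_image)
qed

lemma connected_coded: "Digraph_Component.connected (with_proj coded)"
  unfolding connected_def
proof (rule strongly_connectedI)
  fix m n
  assume "m \<in> verts (with_proj (mk_symmetric (with_proj coded)))"
    and "n \<in> verts (with_proj (mk_symmetric (with_proj coded)))"
  then obtain u v where "m = to_nat u" "n = to_nat v" "u \<in> V" "v \<in> V" by auto
  \<comment> \<open>\<open>D\<close> takes natural values, so the infimum cannot range over an empty
    set of paths.\<close>
  then have "graph_dist (with_proj coded) m n \<noteq> \<infinity>" by (simp add: graph_dist_coded)
  then obtain p where "pg.apath m p n"
    by (cases "{p. pg.apath m p n} = {}") (auto simp: graph_dist_def top_enat_def)
  then show "m \<rightarrow>\<^sup>*\<^bsub>with_proj (mk_symmetric (with_proj coded))\<^esub> n"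
    unfolding pg.apath_def by (intro pg.reachable_mk_symmetricI pg.reachable_awalkI) blast
qed (simp add: V_nonempty)

end

section \<open>The three-path ladder\<close>

datatype vertex = K nat | H | X nat | M nat | Y nat

instance vertex :: countable
  by countable_datatype

fun adj :: "vertex \<Rightarrow> vertex \<Rightarrow> bool" where
  "adj (K i) (K j) \<longleftrightarrow> i \<noteq> j"
| "adj (K i) H \<longleftrightarrow> True"
| "adj H (K i) \<longleftrightarrow> True"
| "adj H (X i) \<longleftrightarrow> i = 0"
| "adj H (M i) \<longleftrightarrow> i = 0"
| "adj H (Y i) \<longleftrightarrow> i = 0"
| "adj (X i) H \<longleftrightarrow> i = 0"
| "adj (M i) H \<longleftrightarrow> i = 0"
| "adj (Y i) H \<longleftrightarrow> i = 0"
| "adj (X i) (X j) \<longleftrightarrow> i = Suc j \<or> j = Suc i"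
| "adj (M i) (M j) \<longleftrightarrow> i = Suc j \<or> j = Suc i"
| "adj (Y i) (Y j) \<longleftrightarrow> i = Suc j \<or> j = Suc i"
| "adj (X i) (M j) \<longleftrightarrow> i = j \<and> even i"
| "adj (M i) (X j) \<longleftrightarrow> i = j \<and> even i"
| "adj (Y i) (M j) \<longleftrightarrow> i = j \<and> odd i"
| "adj (M i) (Y j) \<longleftrightarrow> i = j \<and> odd i"
| "adj _ _ \<longleftrightarrow> False"

definition gap :: "nat \<Rightarrow> nat \<Rightarrow> nat" where
  "gap i j = (i - j) + (j - i)"

text \<open>Distance from the middle path to an outer one; \<open>rung\<close> says whether that
  outer path has a rung at level \<open>i\<close>. Two different levels span a rung on the way. On
  one level without a rung, the detour over the level below costs 3, or 2 through the hub at level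
  0.\<close>

definition mid_dist :: "bool \<Rightarrow> nat \<Rightarrow> nat \<Rightarrow> nat" where
  "mid_dist rung i j =
    (if i \<noteq> j then gap i j + 1 else if rung then 1 else if i = 0 then 2 else 3)"

text \<open>
  The value \<open>5\<close> arises since neither \<open>X i\<close> with \<open>i\<close> odd nor \<open>Y j\<close> with \<open>j\<close> even has a rung of its own;
  for \<open>i = 1\<close>, \<open>j = 0\<close> the way through the hub is shorter.
\<close>

definition cross_dist :: "nat \<Rightarrow> nat \<Rightarrow> nat" where
  "cross_dist i j =
    (if i = j then if i = 0 then 2 else 4
     else if odd i \<and> gap i j = 1 \<and> j \<noteq> 0 then 5 else gap i j + 2)"

fun dst :: "vertex \<Rightarrow> vertex \<Rightarrow> nat" where
  "dst (K i) (K j) = (if i = j then 0 else 1)"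
| "dst (K i) H = 1"
| "dst (K i) (X j) = j + 2"
| "dst (K i) (M j) = j + 2"
| "dst (K i) (Y j) = j + 2"
| "dst H (K i) = 1"
| "dst H H = 0"
| "dst H (X j) = j + 1"
| "dst H (M j) = j + 1"
| "dst H (Y j) = j + 1"
| "dst (X i) (K j) = i + 2"
| "dst (X i) H = i + 1"
| "dst (X i) (X j) = gap i j"
| "dst (X i) (M j) = mid_dist (even i) i j"
| "dst (X i) (Y j) = cross_dist i j"
| "dst (M i) (K j) = i + 2"
| "dst (M i) H = i + 1"
| "dst (M i) (X j) = mid_dist (even i) i j"
| "dst (M i) (M j) = gap i j"
| "dst (M i) (Y j) = mid_dist (odd i) i j"
| "dst (Y i) (K j) = i + 2"
| "dst (Y i) H = i + 1"
| "dst (Y i) (X j) = cross_dist j i"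
| "dst (Y i) (M j) = mid_dist (odd i) i j"
| "dst (Y i) (Y j) = gap i j"

lemmas dst_defs = gap_def mid_dist_def cross_dist_def

text \<open>For \<open>i = j\<close> this moves down, to the level where the missing rung is available.\<close>

definition step_level :: "nat \<Rightarrow> nat \<Rightarrow> nat" where
  "step_level i j = (if i < j then Suc i else i - 1)"

text \<open>The next vertex on a shortest path, as explicit witness for \<open>D_descent\<close>;
  only distinct arguments matter.\<close>

fun toward :: "vertex \<Rightarrow> vertex \<Rightarrow> vertex" where
  "toward (K i) (K j) = K j"
| "toward (K i) _ = H"
| "toward H (K j) = K j"
| "toward H (X j) = X 0"
| "toward H (M j) = M 0"
| "toward H (Y j) = Y 0"
| "toward (X i) (X j) = X (step_level i j)"
| "toward (X i) (M j) = (if even i then M i else X (step_level i j))"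
| "toward (X i) (Y j) = (if i = 0 then H else if even i then M i else X (step_level i j))"
| "toward (X i) _ = (if i = 0 then H else X (i - 1))"
| "toward (M i) (X j) = (if even i then X i else M (step_level i j))"
| "toward (M i) (M j) = M (step_level i j)"
| "toward (M i) (Y j) = (if odd i then Y i else if i = 0 \<and> j = 0 then H else M (step_level i j))"
| "toward (M i) _ = (if i = 0 then H else M (i - 1))"
| "toward (Y i) (X j) = (if i = 0 then H else if odd i then M i else Y (step_level i j))"
| "toward (Y i) (M j) = (if odd i then M i else if i = 0 \<and> j = 0 then H else Y (step_level i j))"
| "toward (Y i) (Y j) = Y (step_level i j)"
| "toward (Y i) _ = (if i = 0 then H else Y (i - 1))"
| "toward H H = H"

definition ladder_verts :: "nat \<Rightarrow> nat \<Rightarrow> vertex set" where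
  "ladder_verts a k = K ` {..<a} \<union> {H} \<union> X ` {..<k} \<union> M ` {..<k} \<union> Y ` {..<k}"

section \<open>Verification of the distance formula\<close>

lemma adj_irrefl: "\<not> adj u u"
  by (cases u) auto

lemma adj_sym: "adj u v \<Longrightarrow> adj v u"
  by (cases u; cases v) auto

lemma dst_refl: "dst u u = 0"
  by (cases u) (auto simp: dst_defs)

lemma dst_step: "adj u v \<Longrightarrow> dst u w \<le> dst v w + 1"
  by (cases u; cases v; cases w; auto simp: dst_defs; presburger)

text \<open>\<open>toward\<close> never climbs above the higher of the two levels, so one distance
  formula serves every height \<open>k\<close>.\<close>

lemma toward_in_verts:
  assumes "u \<in> ladder_verts a k" "w \<in> ladder_verts a k" "u \<noteq> w"
  shows "toward u w \<in> ladder_verts a k"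
  using assms by (cases u; cases w) (auto simp: ladder_verts_def step_level_def)

lemma adj_toward: "u \<noteq> w \<Longrightarrow> adj u (toward u w)"
  by (cases u; cases w) (auto simp: step_level_def)

lemma dst_toward: "u \<noteq> w \<Longrightarrow> dst u w = dst (toward u w) w + 1"
  by (cases u; cases w; auto simp: step_level_def dst_defs; presburger)

locale ladder_graph =
  fixes a k :: nat
  assumes a_ge: "2 \<le> a" and k_ge: "1 \<le> k"
begin

sublocale graph_with_dist "ladder_verts a k" adj dst
proof
  show "finite (ladder_verts a k)" "ladder_verts a k \<noteq> {}"
    by (auto simp: ladder_verts_def)
  show "\<exists>v\<in>ladder_verts a k. adj u v \<and> dst u w = dst v w + 1"
    if "u \<in> ladder_verts a k" "w \<in> ladder_verts a k" "u \<noteq> w" for u w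
    using that toward_in_verts adj_toward dst_toward by blast
qed (simp_all add: adj_irrefl adj_sym dst_refl dst_step[simplified])

section \<open>Characterisation of the resolving sets\<close>

lemma resolving_cliqueD:
  assumes "resolving T" "i < a" "j < a" "i \<noteq> j"
  shows "K i \<in> T \<or> K j \<in> T"
proof -
  have "dst w (K i) = dst w (K j)" if "w \<noteq> K i" "w \<noteq> K j" for w
    using that by (cases w) auto
  moreover have "K i \<in> ladder_verts a k" "K j \<in> ladder_verts a k" "K i \<noteq> K j"
    using assms by (auto simp: ladder_verts_def)
  ultimately show ?thesis using assms(1) unfolding resolving_def by metis
qed

text \<open>The hub, the clique and every \<open>M j\<close> with \<open>j \<noteq> i\<close> are
  equidistant from \<open>X i\<close> and \<open>Y i\<close>.\<close>

lemma resolving_sidesD: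
  assumes "resolving T" "i < k"
  shows "M i \<in> T \<or> (\<exists>j. X j \<in> T \<or> Y j \<in> T)"
proof -
  have "X i \<in> ladder_verts a k" "Y i \<in> ladder_verts a k" "X i \<noteq> Y i"
    using assms by (auto simp: ladder_verts_def)
  with assms(1) obtain w where "w \<in> T" "dst w (X i) \<noteq> dst w (Y i)"
    unfolding resolving_def by metis
  then show ?thesis by (cases w) (auto simp: mid_dist_def split: if_splits)
qed

text \<open>
  The exception for \<open>Y 0\<close> is genuine: through the hub it is at distance \<open>2\<close> from both \<open>X 0\<close> and \<open>M 0\<close>.
\<close>

lemma resolving_bottomD:
  assumes "resolving T"
  shows "\<exists>v\<in>T. v \<noteq> Y 0 \<and> v \<noteq> H \<and> v \<notin> range K"
proof -
  have "X 0 \<in> ladder_verts a k" "M 0 \<in> ladder_verts a k" "X 0 \<noteq> M 0"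
    using k_ge by (auto simp: ladder_verts_def)
  with assms obtain w where "w \<in> T" "dst w (X 0) \<noteq> dst w (M 0)"
    unfolding resolving_def by metis
  then show ?thesis by (intro bexI[of _ w]) (auto simp: dst_defs)
qed

text \<open>The three necessary conditions above are jointly sufficient: a clique vertex reads off
  the level, and the conditions settle the pairs it leaves.\<close>

lemma resolvingI:
  assumes T: "T \<subseteq> ladder_verts a k"
    and clique: "\<And>i j. i < a \<Longrightarrow> j < a \<Longrightarrow> i \<noteq> j \<Longrightarrow> K i \<in> T \<or> K j \<in> T"
    and sides: "\<And>i. i < k \<Longrightarrow> M i \<in> T \<or> (\<exists>j. X j \<in> T \<or> Y j \<in> T)"
    and bottom: "v \<in> T" "v \<noteq> Y 0" "v \<noteq> H" "v \<notin> range K"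
  shows "resolving T"
  unfolding resolving_def
proof (intro conjI T ballI impI)
  fix x y assume xy: "x \<in> ladder_verts a k" "y \<in> ladder_verts a k" "x \<noteq> y"
  obtain c where c: "K c \<in> T" using clique[of 0 1] a_ge by auto
  define sep where "sep p q \<longleftrightarrow> (\<exists>w\<in>T. dst w p \<noteq> dst w q)" for p q
  have sep_sym: "sep p q \<Longrightarrow> sep q p" for p q
    by (auto simp: sep_def) metis
  \<comment> \<open>The single vertex \<open>v\<close> separates the middle path from both outer
    paths at every level.\<close>
  have "dst v (K i) \<noteq> dst v H" "dst v (X i) \<noteq> dst v (M i)" "dst v (Y i) \<noteq> dst v (M i)" for i
    using bottom by (cases v; auto simp: dst_defs)+
  then have vK: "sep (K i) H" and vX: "sep (X i) (M i)" and vY: "sep (Y i) (M i)" for i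
    using bottom(1) unfolding sep_def by blast+
  have KK: "sep (K i) (K j)" if "i < a" "j < a" "i \<noteq> j" for i j
    using clique[OF that] that(3) unfolding sep_def by (metis dst.simps(1) zero_neq_one)
  have XY: "sep (X i) (Y i)" if i: "i < k" for i
    using sides[OF i]
  proof (elim disjE exE)
    assume "M i \<in> T"
    then show ?thesis unfolding sep_def by (rule rev_bexI) (auto simp: dst_defs)
  next
    fix j assume "X j \<in> T"
    then show ?thesis unfolding sep_def by (rule rev_bexI) (auto simp: dst_defs)
  next
    fix j assume "Y j \<in> T"
    then show ?thesis unfolding sep_def by (rule rev_bexI) (auto simp: dst_defs)
  qed
  have "sep x y"
  proof (cases "dst (K c) x = dst (K c) y")
    case True
    \<comment> \<open>What remains are pairs inside the clique with the hub, and pairs on a common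
      level.\<close>
    with xy show ?thesis
      by (cases x; cases y)
        (auto simp: ladder_verts_def KK vK vX vY XY vK[THEN sep_sym] vX[THEN sep_sym]
          vY[THEN sep_sym] XY[THEN sep_sym] split: if_splits)
  next
    case False
    with c show ?thesis unfolding sep_def by blast
  qed
  then show "\<exists>w\<in>T. dst w x \<noteq> dst w y" unfolding sep_def .
qed

section \<open>The two dimensions\<close>

lemma finite_resolving: "resolving T \<Longrightarrow> finite T"
  using finite_V finite_subset by (auto simp: resolving_def)

text \<open>At most one twin is missing, and \<open>resolving_bottomD\<close> demands a further
  vertex outside the clique.\<close>

lemma card_resolving_ge:
  assumes "resolving T"
  shows "a \<le> card T"
proof -
  let ?K = "K ` {..<a}"
  have "x = y" if "x \<in> ?K - T" "y \<in> ?K - T" for x y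
    using that resolving_cliqueD[OF assms] by auto
  then have "card (?K - T) \<le> Suc 0"
    by (subst card_le_Suc0_iff_eq) auto
  moreover have "card ?K = a"
    by (simp add: card_image inj_on_def)
  ultimately have "a \<le> card (T \<inter> ?K) + 1"
    using card_Int_Diff[of ?K T] by (simp add: Int_commute)
  moreover obtain v where v: "v \<in> T" "v \<notin> range K"
    using resolving_bottomD[OF assms] by blast
  then have "card (T \<inter> ?K) + 1 = card (insert v (T \<inter> ?K))"
    using finite_resolving[OF assms] by (subst card_insert_disjoint) auto
  moreover have "\<dots> \<le> card T"
    using v finite_resolving[OF assms] by (intro card_mono) auto
  ultimately show ?thesis by linarith
qed

lemma metric_dim_ladder: "metric_dim (with_proj coded) = a"
proof -
  let ?T = "insert (X 0) (K ` {..<a - 1})"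
  have "resolving ?T"
    using k_ge by (intro resolvingI[where v = "X 0"]) (auto simp: ladder_verts_def image_iff)
  moreover have "card ?T = a"
    using a_ge by (subst card_insert_disjoint) (auto simp: card_image inj_on_def)
  ultimately show ?thesis
    using metric_dim_coded[of ?T] card_resolving_ge by auto
qed

text \<open>Besides \<open>a - 1\<close> twins, at most \<open>k\<close> vertices suffice: all of
  \<open>M\<close>, or one outer vertex other than \<open>Y 0\<close>, or \<open>Y 0\<close> with
  some \<open>M l\<close>.\<close>

lemma resolving_subset_small:
  assumes T: "resolving T"
  shows "\<exists>R\<subseteq>T. resolving R \<and> card R \<le> k + (a - 1)"
proof -
  \<comment> \<open>\<open>c\<close> is the index of the missing twin; if none is missing, one twin
    is discarded.\<close>
  obtain c where c: "c < a" "\<And>i. i < a \<Longrightarrow> i \<noteq> c \<Longrightarrow> K i \<in> T"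
    using resolving_cliqueD[OF T] a_ge by (metis less_le_trans zero_less_numeral)
  define P where "P = K ` ({..<a} - {c})"
  have P: "P \<subseteq> T" "P \<subseteq> ladder_verts a k" "card P = a - 1" "finite P"
    using c by (auto simp: P_def card_image inj_on_def ladder_verts_def)
  have TV: "T \<subseteq> ladder_verts a k" using T by (simp add: resolving_def)
  have resolvingI': "resolving (Q \<union> P)"
    if "Q \<subseteq> T" and "\<And>i. i < k \<Longrightarrow> M i \<in> Q \<or> (\<exists>j. X j \<in> Q \<or> Y j \<in> Q)"
      and "v \<in> Q" "v \<noteq> Y 0" "v \<noteq> H" "v \<notin> range K" for Q v
  proof (rule resolvingI)
    show "Q \<union> P \<subseteq> ladder_verts a k" using that(1) TV P(2) by blast
    show "K i \<in> Q \<union> P \<or> K j \<in> Q \<union> P" if "i < a" "j < a" "i \<noteq> j" for i j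
      using that by (auto simp: P_def)
  qed (use that in auto)
  have "\<exists>Q\<subseteq>T. resolving (Q \<union> P) \<and> card Q \<le> k"
  proof (cases "\<forall>i<k. M i \<in> T")
    case True
    then have "resolving (M ` {..<k} \<union> P)"
      using k_ge by (intro resolvingI'[of _ "M 0"]) auto
    with True show ?thesis
      by (intro exI[of _ "M ` {..<k}"]) (auto simp: card_image inj_on_def)
  next
    case False
    then obtain i where i: "i < k" "M i \<notin> T" by blast
    with resolving_sidesD[OF T] obtain j where j: "X j \<in> T \<or> Y j \<in> T" by blast
    show ?thesis
    proof (cases "\<exists>v\<in>T. v \<in> range X \<union> range Y - {Y 0}")
      case True
      then obtain v where v: "v \<in> T" "v \<in> range X \<union> range Y - {Y 0}" by blast
      then have "resolving ({v} \<union> P)"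
        by (intro resolvingI'[of _ v]) auto
      with v k_ge show ?thesis by (intro exI[of _ "{v}"]) auto
    next
      case False
      with j have Y0: "Y 0 \<in> T" by fastforce
      obtain v where v: "v \<in> T" "v \<noteq> Y 0" "v \<noteq> H" "v \<notin> range K"
        using resolving_bottomD[OF T] by blast
      with False obtain l where l: "v = M l" by (cases v) auto
      \<comment> \<open>\<open>M l\<close> lies in \<open>T\<close> and \<open>M i\<close> does not,
        so there are two levels and the pair fits the bound \<open>k\<close>.\<close>
      with v TV i have "2 \<le> k" by (cases l; cases i) (auto simp: ladder_verts_def)
      moreover have "resolving ({Y 0, v} \<union> P)"
        using v Y0 by (intro resolvingI'[of _ v]) auto
      ultimately show ?thesis
        using v Y0 by (intro exI[of _ "{Y 0, v}"]) auto
    qed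
  qed
  then obtain Q where Q: "Q \<subseteq> T" "resolving (Q \<union> P)" "card Q \<le> k" by blast
  have "card (Q \<union> P) \<le> k + (a - 1)"
    using card_Un_le[of Q P] Q(3) P(3) by linarith
  with Q P(1) show ?thesis by (intro exI[of _ "Q \<union> P"]) auto
qed

lemma upper_dim_ladder: "upper_dim (with_proj coded) = k + (a - 1)"
proof -
  let ?T = "M ` {..<k} \<union> K ` {..<a - 1}"
  have card: "card ?T = k + (a - 1)"
    by (subst card_Un_disjoint) (auto simp: card_image inj_on_def)
  have "resolving ?T"
    using k_ge by (intro resolvingI[where v = "M 0"]) (auto simp: ladder_verts_def image_iff)
  moreover have "\<not> resolving T'" if T': "T' \<subset> ?T" for T'
  proof
    assume res: "resolving T'"
    have "M i \<in> T'" if "i < k" for i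
      using resolving_sidesD[OF res that] T' by auto
    \<comment> \<open>The twin \<open>K (a - 1)\<close> is already left out, so no other one can
      be.\<close>
    moreover have "K i \<in> T'" if "i < a - 1" for i
      using resolving_cliqueD[OF res, of i "a - 1"] that T' by auto
    ultimately show False using T' by blast
  qed
  ultimately show ?thesis
    using upper_dim_coded[of ?T] resolving_subset_small card by simp
qed

end

theorem theorem3p5:
  fixes a b :: nat
  assumes "2 \<le> a" and "a \<le> b"
  shows "\<exists>G :: nat pair_pre_digraph. pair_graph G \<and> Digraph_Component.connected (with_proj G) \<and>
    metric_dim (with_proj G) = a \<and> upper_dim (with_proj G) = b"
proof -
  interpret ladder_graph a "b - a + 1"
    using assms by unfold_locales auto
  have "b - a + 1 + (a - 1) = b" using assms by simp
  then show ?thesis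
    using pair_graph_coded connected_coded metric_dim_ladder upper_dim_ladder by metis
qed

end
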